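(* Let $\mathbb{F}$ be a field of characteristic $2$, $V$ an $n$-dimensional $\mathbb{F}$-vector space and $b$ a non-degenerate symmetric bilinear form on $V$ with attached quadratic form $Q: x\mapsto b(x,x)$. Assume that $\operatorname{Ker} Q$ is totally $b$-singular, and set $\nu := \dim \operatorname{Ker} Q$. Let $\mathcal{V}$ be a linear subspace of $\mathcal{S}_b$ (respectively, of $\mathcal{A}_b$) all of whose elements are nilpotent. Then $\dim \mathcal{V} \le \nu(n-\nu)$ (respectively, $\dim \mathcal{V} \le \nu(n-\nu-1)$).
   Context: $\operatorname{Ker} Q = \{x\in V : Q(x)=0\}$, a linear subspace in characteristic $2$. A subspace $X$ is totally $b$-singular if $b(x,y)=0$ for all $x,y\in X$. $\mathcal{S}_b$ (resp. $\mathcal{A}_b$) is the space of endomorphisms $u$ of $V$ for which $(x,y)\mapsto b(x,u(y))$ is symmetric (resp. alternating, i.e. vanishes on all pairs $(x,x)$). *)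

theory Defs
  imports "HOL-Analysis.Analysis" "HOL-Library.Function_Algebras"
begin

text \<open>The space V is the coordinate space 'a^'n over a field 'a, of dimension n = CARD('n).
  Endomorphisms of V are (F-linear) functions V => V; the space of all functions V => V is
  an F-vector space with the pointwise scalar multiplication endo_scale.\<close>

definition endo_scale :: "'a::field \<Rightarrow> ('a^'n \<Rightarrow> 'a^'n) \<Rightarrow> ('a^'n \<Rightarrow> 'a^'n)" where
  "endo_scale c f = (\<lambda>x. c *s f x)"

definition is_endo :: "('a::field^'n \<Rightarrow> 'a^'n) \<Rightarrow> bool" where
  "is_endo u \<longleftrightarrow> Vector_Spaces.linear (*s) (*s) u"

definition bilinear_form :: "('a::field^'n \<Rightarrow> 'a^'n \<Rightarrow> 'a) \<Rightarrow> bool" where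
  "bilinear_form b \<longleftrightarrow>
     (\<forall>x. Vector_Spaces.linear (*s) (*) (b x)) \<and> (\<forall>y. Vector_Spaces.linear (*s) (*) (\<lambda>x. b x y))"

definition symmetric_form :: "('v \<Rightarrow> 'v \<Rightarrow> 'a) \<Rightarrow> bool" where
  "symmetric_form b \<longleftrightarrow> (\<forall>x y. b x y = b y x)"

definition nondegenerate_form :: "('a::field^'n \<Rightarrow> 'a^'n \<Rightarrow> 'a) \<Rightarrow> bool" where
  "nondegenerate_form b \<longleftrightarrow> (\<forall>x. (\<forall>y. b x y = 0) \<longrightarrow> x = 0)"

text \<open>Ker Q for the quadratic form Q x = b x x.\<close>
definition KerQ :: "('a::field^'n \<Rightarrow> 'a^'n \<Rightarrow> 'a) \<Rightarrow> ('a^'n) set" where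
  "KerQ b = {x. b x x = 0}"

definition totally_singular :: "('v \<Rightarrow> 'v \<Rightarrow> 'a::zero) \<Rightarrow> 'v set \<Rightarrow> bool" where
  "totally_singular b X \<longleftrightarrow> (\<forall>x\<in>X. \<forall>y\<in>X. b x y = 0)"

text \<open>S_b: endomorphisms u with (x,y) |-> b(x,u(y)) symmetric;
  A_b: those with (x,y) |-> b(x,u(y)) alternating.\<close>
definition S_b :: "('a::field^'n \<Rightarrow> 'a^'n \<Rightarrow> 'a) \<Rightarrow> ('a^'n \<Rightarrow> 'a^'n) set" where
  "S_b b = {u. is_endo u \<and> (\<forall>x y. b x (u y) = b y (u x))}"

definition A_b :: "('a::field^'n \<Rightarrow> 'a^'n \<Rightarrow> 'a) \<Rightarrow> ('a^'n \<Rightarrow> 'a^'n) set" where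
  "A_b b = {u. is_endo u \<and> (\<forall>x. b x (u x) = 0)}"

definition nilpotent_endo :: "('a::field^'n \<Rightarrow> 'a^'n) \<Rightarrow> bool" where
  "nilpotent_endo u \<longleftrightarrow> (\<exists>k. (u ^^ k) = (\<lambda>_. 0))"

end

(*
  Let K = Ker Q, nu = dim K and P = K^perp, so that K is a subspace contained in P and
  dim K + dim P = n.
  A nilpotent u in S_b maps P into K: for x in P one has Q(u^m x) = b(x, u^(2m) x), and since
  b(x, -) vanishes on K, descending induction on m kills b(x, u^m x) for all m >= 1.
  Filter the given space by restriction. The restrictions to K form a space of nilpotent
  endomorphisms of K, of dimension at most nu(nu-1)/2 by Gerstenhaber's theorem, proved here by
  a power-series argument that avoids traces and so works in characteristic 2. The maps vanishing
  on K restrict to maps P -> K vanishing on K, at most nu(dim P - nu) dimensions. The maps vanishing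
  on P are b-self-adjoint with values in P^perp, which has dimension nu; such spaces have dimension
  at most nu(nu+1)/2, and at most nu(nu-1)/2 in the alternating case. Adding up with
  dim P = n - nu gives both bounds.
*)
theory Submission
  imports Defs
begin

section \<open>Dimension bounds without finite-dimensionality\<close>

context vector_space begin

text \<open>\<open>dim\<close> is 0 on infinite-dimensional sets, and the space of all functions
  \<open>'a^'n \<Rightarrow> 'a^'n\<close> is infinite-dimensional for infinite \<open>'a\<close>; \<open>dim_at_most S k\<close> also
  asserts that \<open>S\<close> is finite-dimensional.\<close>

definition dim_at_most :: "'b set \<Rightarrow> nat \<Rightarrow> bool" where
  "dim_at_most S k \<longleftrightarrow> (\<forall>B. B \<subseteq> S \<longrightarrow> local.independent B \<longrightarrow> finite B \<longrightarrow> card B \<le> k)"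

lemma dim_le_if_dim_at_most: "local.dim S \<le> k" if "local.dim_at_most S k"
proof -
  obtain B where B: "B \<subseteq> S" "local.independent B" "S \<subseteq> local.span B" "card B = local.dim S"
    by (rule basis_exists)
  then show ?thesis
    using that unfolding dim_at_most_def by (cases "finite B") auto
qed

lemma dim_at_most_mono: "local.dim_at_most S k \<Longrightarrow> k \<le> k' \<Longrightarrow> local.dim_at_most S k'"
  unfolding dim_at_most_def by (meson order_trans)

lemma dim_at_most_zero: "S \<subseteq> {0} \<Longrightarrow> local.dim_at_most S 0"
  unfolding dim_at_most_def using dependent_zero by (auto dest: subset_singletonD)

lemma span_Int_span_eq_zero:
  assumes ind: "local.independent (A \<union> C)" and dis: "A \<inter> C = {}"
  shows "local.span A \<inter> local.span C = {0}"
proof -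
  have "v = 0" if vA: "v \<in> local.span A" and vC: "v \<in> local.span C" for v
  proof -
    from vA obtain ta r where ta: "finite ta" "ta \<subseteq> A" "v = (\<Sum>a\<in>ta. scale (r a) a)"
      by (auto simp: span_explicit)
    from vC obtain tc s where tc: "finite tc" "tc \<subseteq> C" "v = (\<Sum>a\<in>tc. scale (s a) a)"
      by (auto simp: span_explicit)
    define t where "t a = (if a \<in> ta then r a else - s a)" for a
    have dj: "ta \<inter> tc = {}" using ta tc dis by auto
    have "(\<Sum>a\<in>ta. scale (t a) a) = v" using ta by (simp add: t_def)
    moreover have "(\<Sum>a\<in>tc. scale (t a) a) = (\<Sum>a\<in>tc. - scale (s a) a)"
      using dj by (intro sum.cong) (auto simp: t_def)
    ultimately have "(\<Sum>a\<in>ta \<union> tc. scale (t a) a) = 0"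
      using ta tc dj by (simp add: sum.union_disjoint sum_negf)
    then have "t a = 0" if "a \<in> ta" for a
      using independentD[OF ind] ta tc that by blast
    then show "v = 0" using ta by (simp add: t_def)
  qed
  then show ?thesis by (auto intro: span_zero)
qed

end

context vector_space_pair begin

lemma subspace_kernel_within:
  assumes "Vector_Spaces.linear s1 s2 f" and "vs1.subspace S"
  shows "vs1.subspace {x\<in>S. f x = 0}"
  using vs1.subspace_inter[OF assms(2) linear_subspace_kernel[OF assms(1)]]
  by (simp add: Collect_conj_eq Int_commute)

lemma dim_at_most_rank_nullity:
  assumes lin: "Vector_Spaces.linear s1 s2 f" and S: "vs1.subspace S"
    and img: "vs2.dim_at_most (f ` S) a"
    and ker: "vs1.dim_at_most {x\<in>S. f x = 0} b"
  shows "vs1.dim_at_most S (a + b)"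
  unfolding vs1.dim_at_most_def
proof (intro allI impI)
  fix B assume BS: "B \<subseteq> S" and indB: "vs1.independent B" and finB: "finite B"
  obtain B0 where B0: "B0 \<subseteq> vs1.span B \<inter> {x. f x = 0}" "vs1.independent B0"
      "vs1.span B \<inter> {x. f x = 0} \<subseteq> vs1.span B0"
    by (rule vs1.basis_exists)
  then have B0B: "B0 \<subseteq> vs1.span B" by blast
  obtain B1 where B1: "B0 \<subseteq> B1" "B1 \<subseteq> vs1.span B" "vs1.independent B1"
      "vs1.span B \<subseteq> vs1.span B1"
    by (rule vs1.maximal_independent_subset_extend[OF B0B B0(2)])
  have finB1: "finite B1"
    using vs1.independent_span_bound[OF finB B1(3,2)] by simp
  have "vs1.span B1 = vs1.span B"
    using B1(4) vs1.span_minimal[OF B1(2) vs1.subspace_span] by blast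
  then have cardB: "card B = card B1"
    using vs1.dim_eq_card[OF _ B1(3)] vs1.dim_eq_card[OF refl indB] by simp
  define C where "C = B1 - B0"
  have spanS: "vs1.span B \<subseteq> S" using BS S by (simp add: vs1.span_minimal)
  have "inj_on f (vs1.span C)"
    unfolding linear_inj_on_iff_eq_0[OF lin vs1.subspace_span]
  proof (intro ballI impI)
    fix v assume vC: "v \<in> vs1.span C" and "f v = 0"
    moreover have "vs1.span C \<subseteq> vs1.span B"
      using B1(2) C_def vs1.span_minimal[OF _ vs1.subspace_span] by blast
    ultimately have "v \<in> vs1.span B0" using B0(3) by blast
    then show "v = 0"
      using vs1.span_Int_span_eq_zero[of B0 C] vC B1(1,3) C_def by (auto simp: Un_absorb1)
  qed
  then have "vs2.independent (f ` C)" and "card (f ` C) = card C"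
    using linear_independent_injective_image[OF lin] vs1.independent_mono[OF B1(3)]
      card_image[OF inj_on_subset[OF _ vs1.span_superset]] C_def by auto
  moreover have "f ` C \<subseteq> f ` S" using B1(2) spanS C_def by blast
  ultimately have "card C \<le> a"
    using img finB1 C_def unfolding vs2.dim_at_most_def by (metis finite_Diff finite_imageI)
  moreover have "card B0 \<le> b"
    using ker B0 spanS finite_subset[OF B1(1) finB1] unfolding vs1.dim_at_most_def by blast
  moreover have "card B1 = card C + card B0"
    using B1(1) finB1 C_def by (simp add: card_Diff_subset card_mono finite_subset)
  ultimately show "card B \<le> a + b" using cardB by simp
qed

end

context finite_dimensional_vector_space begin

lemma dim_at_most_dim: "S \<subseteq> T \<Longrightarrow> local.dim_at_most S (local.dim T)"
  unfolding dim_at_most_def using independent_card_le_dim by blast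

end

section \<open>Spaces of maps\<close>

interpretation endo: vector_space "endo_scale :: 'a::field \<Rightarrow> ('a^'n \<Rightarrow> 'a^'n) \<Rightarrow> _"
  by unfold_locales (auto simp: endo_scale_def fun_eq_iff vector_add_ldistrib vector_sadd_rdistrib)

interpretation endo_vec: vector_space_pair "endo_scale :: 'a::field \<Rightarrow> ('a^'n \<Rightarrow> 'a^'n) \<Rightarrow> _" "(*s)"
  by unfold_locales

interpretation endo_endo: vector_space_pair "endo_scale :: 'a::field \<Rightarrow> ('a^'n \<Rightarrow> 'a^'n) \<Rightarrow> _" endo_scale
  by unfold_locales

definition linear_on :: "('a::field^'n) set \<Rightarrow> ('a^'n \<Rightarrow> 'a^'n) \<Rightarrow> bool" where
  "linear_on E u \<longleftrightarrow>
     (\<forall>x\<in>E. \<forall>y\<in>E. u (x + y) = u x + u y) \<and> (\<forall>c. \<forall>x\<in>E. u (c *s x) = c *s u x)"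

text \<open>A linear map \<open>E \<rightarrow> T\<close> is encoded as a function on the whole space that vanishes
  outside \<open>E\<close>, so that such maps form a subspace of the space of all functions.\<close>

definition hom_on :: "('a::field^'n) set \<Rightarrow> ('a^'n) set \<Rightarrow> ('a^'n \<Rightarrow> 'a^'n) \<Rightarrow> bool" where
  "hom_on E T u \<longleftrightarrow> linear_on E u \<and> (\<forall>v\<in>E. u v \<in> T) \<and> (\<forall>v. v \<notin> E \<longrightarrow> u v = 0)"

definition nilpotent_on :: "('a::field^'n) set \<Rightarrow> ('a^'n \<Rightarrow> 'a^'n) \<Rightarrow> bool" where
  "nilpotent_on E u \<longleftrightarrow> (\<exists>k. \<forall>v\<in>E. (u ^^ k) v = 0)"

definition zero_outside :: "'b set \<Rightarrow> ('b \<Rightarrow> 'c::zero) \<Rightarrow> 'b \<Rightarrow> 'c" where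
  "zero_outside E f v = (if v \<in> E then f v else 0)"

lemma linear_on_zero: "vec.subspace E \<Longrightarrow> linear_on E u \<Longrightarrow> u 0 = 0"
  unfolding linear_on_def by (metis vec.subspace_0 vector_smult_lzero)

lemma linear_on_if_is_endo: "is_endo u \<Longrightarrow> linear_on E u"
  unfolding linear_on_def is_endo_def by (simp add: vec.linear_add vec.linear_scale)

lemma subspace_linear_on_kernel:
  assumes "vec.subspace E" and "linear_on E u"
  shows "vec.subspace {v\<in>E. u v = 0}"
  using assms linear_on_zero[OF assms]
  unfolding vec.subspace_def linear_on_def by auto

lemma linear_on_span_eq_zero:
  assumes E: "vec.subspace E" and u: "linear_on E u" and "X \<subseteq> E" and "\<forall>x\<in>X. u x = 0"
    and "y \<in> vec.span X"
  shows "u y = 0"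
  using vec.span_minimal[OF _ subspace_linear_on_kernel[OF E u]] assms(3-) by blast

lemma linear_on_sum:
  assumes E: "vec.subspace E" and u: "linear_on E u"
  shows "finite I \<Longrightarrow> (\<forall>i\<in>I. v i \<in> E) \<Longrightarrow> u (\<Sum>i\<in>I. c i *s v i) = (\<Sum>i\<in>I. c i *s u (v i))"
proof (induction I rule: finite_induct)
  case empty
  then show ?case using linear_on_zero[OF E u] by simp
next
  case (insert i I)
  have "(\<Sum>i\<in>I. c i *s v i) \<in> E"
    using insert.prems by (intro vec.subspace_sum[OF E] vec.subspace_scale[OF E]) auto
  moreover have "c i *s v i \<in> E" using insert.prems vec.subspace_scale[OF E] by simp
  ultimately show ?case
    using insert u unfolding linear_on_def by simp
qed

lemma hom_on_eq_zero: "hom_on E T u \<Longrightarrow> \<forall>v\<in>E. u v = 0 \<Longrightarrow> u = 0"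
  unfolding hom_on_def by (auto simp: fun_eq_iff)

lemma hom_on_zero_space:
  assumes "vec.subspace E" and "E \<subseteq> {0}" and "hom_on E T u"
  shows "u = 0"
proof -
  have "u 0 = 0" using assms(3) linear_on_zero[OF assms(1)] unfolding hom_on_def by blast
  then show ?thesis using assms(2,3) hom_on_eq_zero by (metis singletonD subsetD)
qed

lemma maps_into_zero: "(\<And>u v. u \<in> S \<Longrightarrow> u v \<in> T) \<Longrightarrow> T \<subseteq> {0} \<Longrightarrow> S \<subseteq> {0}"
  by (auto simp: fun_eq_iff subset_iff)

lemma funpow_mem: "\<forall>v\<in>E. u v \<in> E \<Longrightarrow> x \<in> E \<Longrightarrow> (u ^^ j) x \<in> E"
  by (induction j) auto

lemma funpow_eq_zero_beyond:
  assumes "\<forall>v\<in>E. u v \<in> E" and "\<forall>v\<in>E. (u ^^ k) v = 0" and "k \<le> m" and "x \<in> E"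
  shows "(u ^^ m) x = 0"
proof -
  have "(u ^^ m) x = (u ^^ k) ((u ^^ (m - k)) x)"
    using \<open>k \<le> m\<close> by (metis funpow_add le_add_diff_inverse comp_apply)
  then show ?thesis using assms funpow_mem[OF assms(1,4)] by simp
qed

lemma linear_eval: "Vector_Spaces.linear (endo_scale :: 'a::field \<Rightarrow> ('a^'n \<Rightarrow> 'a^'n) \<Rightarrow> _) (*s) (\<lambda>u. u v)"
  by unfold_locales (simp_all add: endo_scale_def)

lemma linear_zero_outside:
  "Vector_Spaces.linear endo_scale endo_scale (zero_outside H :: ('a::field^'n \<Rightarrow> 'a^'n) \<Rightarrow> _)"
  by unfold_locales (auto simp: endo_scale_def zero_outside_def fun_eq_iff)

lemma hom_on_zero_outside:
  assumes "vec.subspace E" and "is_endo u" and "\<forall>v\<in>E. u v \<in> T"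
  shows "hom_on E T (zero_outside E u)"
  using assms linear_on_if_is_endo[OF assms(2)]
  unfolding hom_on_def linear_on_def zero_outside_def
  by (simp add: vec.subspace_add vec.subspace_scale)

lemma funpow_zero_outside:
  assumes "\<forall>v\<in>E. u v \<in> E" and "v \<in> E"
  shows "(zero_outside E u ^^ m) v = (u ^^ m) v"
  by (induction m) (use funpow_mem[OF assms] in \<open>auto simp: zero_outside_def\<close>)

section \<open>Bilinear forms\<close>

interpretation vec_scalar: vector_space_pair "(*s) :: 'a::field \<Rightarrow> 'a^'n \<Rightarrow> 'a^'n" "(*) :: 'a \<Rightarrow> 'a \<Rightarrow> 'a"
  by unfold_locales

lemma bilinear_form_linear_left: "bilinear_form b \<Longrightarrow> Vector_Spaces.linear (*s) (*) (\<lambda>x. b x y)"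
  and bilinear_form_linear_right: "bilinear_form b \<Longrightarrow> Vector_Spaces.linear (*s) (*) (b x)"
  unfolding bilinear_form_def by blast+

lemma bilinear_form_add_left: "bilinear_form b \<Longrightarrow> b (x + y) z = b x z + b y z"
  and bilinear_form_add_right: "bilinear_form b \<Longrightarrow> b x (y + z) = b x y + b x z"
  and bilinear_form_scale_left: "bilinear_form b \<Longrightarrow> b (c *s x) y = c * b x y"
  and bilinear_form_scale_right: "bilinear_form b \<Longrightarrow> b x (c *s y) = c * b x y"
  using bilinear_form_linear_left[of b] bilinear_form_linear_right[of b]
  unfolding Vector_Spaces.linear_iff by blast+

lemma bilinear_form_zero_left: "bilinear_form b \<Longrightarrow> b 0 y = 0"
  and bilinear_form_zero_right: "bilinear_form b \<Longrightarrow> b x 0 = 0"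
  using bilinear_form_scale_left[of b 0 0 y] bilinear_form_scale_right[of b x 0 0] by simp_all

definition orth :: "('a::field^'n \<Rightarrow> 'a^'n \<Rightarrow> 'a) \<Rightarrow> ('a^'n) set \<Rightarrow> ('a^'n) set" where
  "orth b A = {v. \<forall>w\<in>A. b v w = 0}"

lemma subspace_orth: "bilinear_form b \<Longrightarrow> vec.subspace (orth b A)"
  unfolding vec.subspace_def orth_def
  by (simp add: bilinear_form_zero_left bilinear_form_add_left bilinear_form_scale_left)

lemma orth_span: "bilinear_form b \<Longrightarrow> orth b (vec.span X) = orth b X"
  unfolding orth_def
  using vec_scalar.linear_eq_0_on_span[OF bilinear_form_linear_right] vec.span_base by blast

lemma sum_form_eq_zero_iff:
  assumes "vec.independent W"
  shows "(\<Sum>w\<in>W. b v w *s w) = 0 \<longleftrightarrow> v \<in> orth b W"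
  using vec.independentD[OF assms vec.finiteI_independent[OF assms] subset_refl]
  unfolding orth_def by auto

lemma linear_sum_form:
  assumes "bilinear_form b"
  shows "Vector_Spaces.linear (*s) (*s) (\<lambda>v. \<Sum>w\<in>W. b v w *s (w :: 'a::field^'n))"
  by unfold_locales
    (simp_all add: bilinear_form_add_left[OF assms] bilinear_form_scale_left[OF assms]
      vector_sadd_rdistrib sum.distrib vec.scale_sum_right)

lemma sum_form_in_span: "(\<Sum>w\<in>W. b v w *s w) \<in> vec.span W"
  by (intro vec.span_sum vec.span_scale vec.span_base)

lemma dim_orth_lower:
  fixes b :: "'a::field^'n \<Rightarrow> 'a^'n \<Rightarrow> 'a"
  assumes bil: "bilinear_form b"
  shows "CARD('n) \<le> vec.dim A + vec.dim (orth b A)"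
proof -
  obtain B where B: "B \<subseteq> A" "vec.independent B" "A \<subseteq> vec.span B" "card B = vec.dim A"
    by (rule vec.basis_exists)
  have "orth b A = orth b B"
    using B(1,3) orth_span[OF bil, of B] unfolding orth_def by blast
  then have ker: "{v \<in> UNIV. (\<Sum>w\<in>B. b v w *s w) = 0} = orth b A"
    using sum_form_eq_zero_iff[OF B(2)] by blast
  have "vec.dim_at_most (UNIV :: ('a^'n) set) (vec.dim (vec.span B) + vec.dim (orth b A))"
  proof (rule vec.dim_at_most_rank_nullity[OF linear_sum_form[OF bil] vec.subspace_UNIV])
    show "vec.dim_at_most ((\<lambda>v. \<Sum>w\<in>B. b v w *s w) ` UNIV) (vec.dim (vec.span B))"
      by (rule vec.dim_at_most_dim) (auto intro: sum_form_in_span)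
    show "vec.dim_at_most {v \<in> UNIV. (\<Sum>w\<in>B. b v w *s w) = 0} (vec.dim (orth b A))"
      unfolding ker by (rule vec.dim_at_most_dim) simp
  qed
  then have "vec.dim (UNIV :: ('a^'n) set) \<le> vec.dim (vec.span B) + vec.dim (orth b A)"
    by (rule vec.dim_le_if_dim_at_most)
  then show ?thesis
    using vec.dim_span_eq_card_independent[OF B(2)] B(4) by (simp add: card_cart_basis)
qed

lemma dim_orth_upper:
  fixes b :: "'a::field^'n \<Rightarrow> 'a^'n \<Rightarrow> 'a"
  assumes bil: "bilinear_form b" and nondeg: "nondegenerate_form b"
  shows "vec.dim A + vec.dim (orth b A) \<le> CARD('n)"
proof -
  obtain B where B: "B \<subseteq> A" "vec.independent B" "A \<subseteq> vec.span B" "card B = vec.dim A"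
    by (rule vec.basis_exists)
  obtain C where C: "B \<subseteq> C" "C \<subseteq> UNIV" "vec.independent C" "UNIV \<subseteq> vec.span C"
    by (rule vec.maximal_independent_subset_extend[OF subset_UNIV B(2)])
  have finC: "finite C" by (rule vec.finiteI_independent[OF C(3)])
  have "vec.span C = UNIV" using C(4) by auto
  then have cardC: "card C = CARD('n)"
    using vec.dim_span_eq_card_independent[OF C(3)] by (simp add: card_cart_basis)
  define h where "h = (\<lambda>v. \<Sum>w\<in>C. b v w *s w)"
  have "inj h"
    unfolding h_def vec.linear_inj_iff_eq_0[OF linear_sum_form[OF bil]]
  proof (intro allI impI)
    fix v assume "(\<Sum>w\<in>C. b v w *s w) = 0"
    then have "v \<in> orth b (vec.span C)"
      using sum_form_eq_zero_iff[OF C(3)] orth_span[OF bil, of C] by simp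
    then have "\<forall>y. b v y = 0"
      using C(4) unfolding orth_def by blast
    then show "v = 0" using nondeg unfolding nondegenerate_form_def by blast
  qed
  have "h ` orth b A \<subseteq> vec.span (C - B)"
  proof
    fix y assume "y \<in> h ` orth b A"
    then obtain v where v: "v \<in> orth b A" "y = h v" by blast
    have "b v w *s w \<in> vec.span (C - B)" if "w \<in> C" for w
      using v(1) B(1) that
      by (cases "w \<in> B") (auto simp: orth_def subset_iff vec.span_zero intro: vec.span_scale vec.span_base)
    then show "y \<in> vec.span (C - B)" unfolding v(2) h_def by (intro vec.span_sum)
  qed
  then have "vec.dim (h ` orth b A) \<le> vec.dim (vec.span (C - B))"
    by (rule vec.dim_subset)
  also have "\<dots> = card C - card B"
    using vec.independent_mono[OF C(3), of "C - B"] finite_subset[OF C(1) finC] C(1)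
    by (simp add: vec.dim_eq_card_independent card_Diff_subset)
  moreover have "vec.dim (h ` orth b A) = vec.dim (orth b A)"
    using vec.dim_image_eq[OF linear_sum_form[OF bil, of C], folded h_def]
      inj_on_subset[OF \<open>inj h\<close> subset_UNIV] by blast
  ultimately show ?thesis
    using B(4) C(1) finC cardC card_mono[of C B] by simp
qed

lemma dim_orth:
  fixes b :: "'a::field^'n \<Rightarrow> 'a^'n \<Rightarrow> 'a"
  assumes "bilinear_form b" and "nondegenerate_form b"
  shows "vec.dim A + vec.dim (orth b A) = CARD('n)"
  using dim_orth_lower[OF assms(1)] dim_orth_upper[OF assms] by (rule antisym[rotated])

definition self_adjoint :: "('v \<Rightarrow> 'v \<Rightarrow> 'a) \<Rightarrow> ('v \<Rightarrow> 'v) \<Rightarrow> bool" where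
  "self_adjoint b u \<longleftrightarrow> (\<forall>x y. b (u x) y = b x (u y))"

section \<open>Dimension of spaces of maps\<close>

lemma dim_at_most_hom_on_vanishing:
  fixes S :: "('a::field^'n \<Rightarrow> 'a^'n) set"
  assumes E: "vec.subspace E" and A: "vec.subspace A" "A \<subseteq> E" and S: "endo.subspace S"
    and hom: "\<And>u. u \<in> S \<Longrightarrow> hom_on E T u"
    and vanish: "\<And>u a. u \<in> S \<Longrightarrow> a \<in> A \<Longrightarrow> u a = 0"
  shows "endo.dim_at_most S (vec.dim T * (vec.dim E - vec.dim A))"
  using A S hom vanish
proof (induction "vec.dim E - vec.dim A" arbitrary: A S rule: less_induct)
  case less
  show ?case
  proof (cases "E \<subseteq> A")
    case True
    then have "S \<subseteq> {0}" using hom_on_eq_zero less.prems(4,5) by blast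
    then show ?thesis using endo.dim_at_most_zero endo.dim_at_most_mono by blast
  next
    case False
    then obtain v where v: "v \<in> E" "v \<notin> A" by blast
    define A' where "A' = vec.span (insert v A)"
    have A': "vec.subspace A'" "A' \<subseteq> E"
      using v(1) less.prems(2) vec.span_minimal[OF _ E, of "insert v A"] unfolding A'_def by auto
    have "v \<notin> vec.span A" using v(2) vec.span_eq_iff less.prems(1) by blast
    then have dimA': "vec.dim A' = Suc (vec.dim A)" unfolding A'_def by (simp add: vec.dim_insert)
    moreover have "vec.dim A' \<le> vec.dim E" using A'(2) by (rule vec.dim_subset)
    ultimately have less_dim: "vec.dim E - vec.dim A' < vec.dim E - vec.dim A" by simp
    have "endo.dim_at_most {u\<in>S. u v = 0} (vec.dim T * (vec.dim E - vec.dim A'))"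
    proof (rule less.hyps[OF less_dim A'])
      show "endo.subspace {u\<in>S. u v = 0}"
        by (rule endo_vec.subspace_kernel_within[OF linear_eval less.prems(3)])
      show "hom_on E T u" if "u \<in> {u\<in>S. u v = 0}" for u
        using that less.prems(4) by blast
      fix u a assume "u \<in> {u\<in>S. u v = 0}" and "a \<in> A'"
      then show "u a = 0"
        using linear_on_span_eq_zero[OF E, of u "insert v A"] less.prems(2,4,5) v(1)
        unfolding A'_def hom_on_def by blast
    qed
    moreover have "vec.dim_at_most ((\<lambda>u. u v) ` S) (vec.dim T)"
      using less.prems(4) v(1) unfolding hom_on_def by (intro vec.dim_at_most_dim) blast
    ultimately have "endo.dim_at_most S (vec.dim T + vec.dim T * (vec.dim E - vec.dim A'))"
      using endo_vec.dim_at_most_rank_nullity[OF linear_eval less.prems(3)] by blast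
    also have "vec.dim T + vec.dim T * (vec.dim E - vec.dim A') = vec.dim T * (vec.dim E - vec.dim A)"
      using dimA' less_dim by (simp add: Suc_diff_Suc flip: mult_Suc_right)
    finally show ?thesis .
  qed
qed

lemma exists_orth_section:
  fixes b :: "'a::field^'n \<Rightarrow> 'a^'n \<Rightarrow> 'a"
  assumes bil: "bilinear_form b" and nondeg: "nondegenerate_form b"
    and T: "vec.subspace T" and nonzero: "\<not> T \<subseteq> {0}"
  obtains v where "vec.subspace (T \<inter> orth b {v})" and "vec.dim (T \<inter> orth b {v}) < vec.dim T"
    and "\<And>u w. self_adjoint b u \<Longrightarrow> u v = 0 \<Longrightarrow> u w \<in> T \<Longrightarrow> u w \<in> T \<inter> orth b {v}"
    and "\<And>u. self_adjoint b u \<Longrightarrow> b v (u v) = 0 \<Longrightarrow> u v \<in> T \<Longrightarrow> u v \<in> T \<inter> orth b {v}"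
proof -
  obtain x where x: "x \<in> T" "x \<noteq> 0" using nonzero by blast
  then obtain v where "b x v \<noteq> 0" using nondeg unfolding nondegenerate_form_def by blast
  then have "T \<inter> orth b {v} \<subset> T" using x(1) unfolding orth_def by blast
  moreover have sub: "vec.subspace (T \<inter> orth b {v})"
    by (rule vec.subspace_inter[OF T subspace_orth[OF bil]])
  ultimately have "vec.dim (T \<inter> orth b {v}) < vec.dim T"
    using vec.dim_psubset T vec.span_eq_iff by metis
  moreover have "u w \<in> T \<inter> orth b {v}"
    if "self_adjoint b u" "u v = 0" "u w \<in> T" for u w
    using that bilinear_form_zero_right[OF bil] unfolding self_adjoint_def orth_def by simp
  moreover have "u v \<in> T \<inter> orth b {v}"
    if "self_adjoint b u" "b v (u v) = 0" "u v \<in> T" for u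
    using that unfolding self_adjoint_def orth_def by simp
  ultimately show ?thesis using sub that by blast
qed

lemma dim_at_most_self_adjoint:
  fixes b :: "'a::field^'n \<Rightarrow> 'a^'n \<Rightarrow> 'a" and S :: "('a^'n \<Rightarrow> 'a^'n) set"
  assumes bil: "bilinear_form b" and nondeg: "nondegenerate_form b"
    and "vec.subspace T" and "vec.dim T \<le> t" and "endo.subspace S"
    and "\<And>u. u \<in> S \<Longrightarrow> self_adjoint b u" and "\<And>u v. u \<in> S \<Longrightarrow> u v \<in> T"
  shows "endo.dim_at_most S (t * (t + 1) div 2)"
  using assms(3-)
proof (induction t arbitrary: T S rule: less_induct)
  case (less t)
  show ?case
  proof (cases "T \<subseteq> {0}")
    case True
    then have "S \<subseteq> {0}" using maps_into_zero less.prems(5) by blast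
    then show ?thesis using endo.dim_at_most_zero endo.dim_at_most_mono by blast
  next
    case False
    then obtain v where v: "vec.subspace (T \<inter> orth b {v})" "vec.dim (T \<inter> orth b {v}) < vec.dim T"
      and ker: "\<And>u w. self_adjoint b u \<Longrightarrow> u v = 0 \<Longrightarrow> u w \<in> T \<Longrightarrow> u w \<in> T \<inter> orth b {v}"
      by (rule exists_orth_section[OF bil nondeg less.prems(1)]) blast
    then obtain s where t: "t = Suc s" and dim_v: "vec.dim (T \<inter> orth b {v}) \<le> s"
      using less.prems(2) by (cases t) auto
    have "endo.dim_at_most {u\<in>S. u v = 0} (s * (s + 1) div 2)"
      by (rule less.IH[OF _ v(1) dim_v endo_vec.subspace_kernel_within[OF linear_eval less.prems(3)]])
        (use t ker less.prems(4,5) in auto)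
    moreover have "vec.dim_at_most ((\<lambda>u. u v) ` S) t"
      using less.prems(5) by (intro vec.dim_at_most_mono[OF vec.dim_at_most_dim less.prems(2)]) blast
    ultimately have "endo.dim_at_most S (t + s * (s + 1) div 2)"
      using endo_vec.dim_at_most_rank_nullity[OF linear_eval less.prems(3)] by blast
    also have "t + s * (s + 1) div 2 = t * (t + 1) div 2"
      unfolding t by (simp add: algebra_simps)
    finally show ?thesis .
  qed
qed

lemma dim_at_most_alternating_self_adjoint:
  fixes b :: "'a::field^'n \<Rightarrow> 'a^'n \<Rightarrow> 'a" and S :: "('a^'n \<Rightarrow> 'a^'n) set"
  assumes bil: "bilinear_form b" and nondeg: "nondegenerate_form b"
    and "vec.subspace T" and "vec.dim T \<le> t" and "endo.subspace S"
    and "\<And>u. u \<in> S \<Longrightarrow> self_adjoint b u" and "\<And>u v. u \<in> S \<Longrightarrow> u v \<in> T"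
    and "\<And>u x. u \<in> S \<Longrightarrow> b x (u x) = 0"
  shows "endo.dim_at_most S (t * (t - 1) div 2)"
  using assms(3-)
proof (induction t arbitrary: T S rule: less_induct)
  case (less t)
  show ?case
  proof (cases "T \<subseteq> {0}")
    case True
    then have "S \<subseteq> {0}" using maps_into_zero less.prems(5) by blast
    then show ?thesis using endo.dim_at_most_zero endo.dim_at_most_mono by blast
  next
    case False
    then obtain v where v: "vec.subspace (T \<inter> orth b {v})" "vec.dim (T \<inter> orth b {v}) < vec.dim T"
      and ker: "\<And>u w. self_adjoint b u \<Longrightarrow> u v = 0 \<Longrightarrow> u w \<in> T \<Longrightarrow> u w \<in> T \<inter> orth b {v}"
      and img: "\<And>u. self_adjoint b u \<Longrightarrow> b v (u v) = 0 \<Longrightarrow> u v \<in> T \<Longrightarrow> u v \<in> T \<inter> orth b {v}"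
      by (rule exists_orth_section[OF bil nondeg less.prems(1)]) blast
    then obtain s where t: "t = Suc s" and dim_v: "vec.dim (T \<inter> orth b {v}) \<le> s"
      using less.prems(2) by (cases t) auto
    have "endo.dim_at_most {u\<in>S. u v = 0} (s * (s - 1) div 2)"
      by (rule less.IH[OF _ v(1) dim_v endo_vec.subspace_kernel_within[OF linear_eval less.prems(3)]])
        (use t ker less.prems(4-6) in auto)
    moreover have "vec.dim_at_most ((\<lambda>u. u v) ` S) s"
      using img less.prems(4-6) by (intro vec.dim_at_most_mono[OF vec.dim_at_most_dim dim_v]) blast
    ultimately have "endo.dim_at_most S (s + s * (s - 1) div 2)"
      using endo_vec.dim_at_most_rank_nullity[OF linear_eval less.prems(3)] by blast
    also have "s + s * (s - 1) div 2 = t * (t - 1) div 2"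
      unfolding t by (cases s) (simp_all add: algebra_simps)
    finally show ?thesis .
  qed
qed

section \<open>Gerstenhaber's theorem on nilpotent spaces\<close>

text \<open>The coefficients of \<open>1 / (1 - t C(t))\<close> for \<open>C(t) = \<Sum>j. c j t^j\<close>. The next lemma says
  that this power series is a polynomial only if \<open>C = 0\<close>. For a map \<open>z\<close> with values in
  \<open>span {x}\<close> they express \<open>(u + z)^N x\<close> through the \<open>u^j x\<close>, where \<open>c j\<close> is the
  \<open>x\<close>-coordinate of \<open>z (u^j x)\<close>.\<close>

fun inverse_series_coeff :: "(nat \<Rightarrow> 'a::comm_ring_1) \<Rightarrow> nat \<Rightarrow> 'a" where
  "inverse_series_coeff c 0 = 1"
| "inverse_series_coeff c (Suc N) = (\<Sum>j\<le>N. c j * inverse_series_coeff c (N - j))"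

lemma inverse_series_coeff_eventually_zero_imp_zero:
  fixes c :: "nat \<Rightarrow> 'a::idom"
  assumes c: "\<forall>j\<ge>p. c j = 0" and g: "\<forall>N\<ge>k. inverse_series_coeff c N = 0"
  shows "c j = 0"
proof (rule ccontr)
  assume "c j \<noteq> 0"
  define g where "g = inverse_series_coeff c"
  define Cs where "Cs = {j. c j \<noteq> 0}"
  define Gs where "Gs = {N. g N \<noteq> 0}"
  have "Cs \<subseteq> {..<p}" and "Gs \<subseteq> {..<k}"
    using c g unfolding Cs_def Gs_def g_def by (auto simp: not_less[symmetric])
  then have fin: "finite Cs" "finite Gs" by (auto intro: finite_subset)
  have "j \<in> Cs" and "0 \<in> Gs" using \<open>c j \<noteq> 0\<close> unfolding Cs_def Gs_def g_def by simp_all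
  define bm where "bm = Max Cs"
  define am where "am = Max Gs"
  have bm: "bm \<in> Cs" "\<And>j. j \<in> Cs \<Longrightarrow> j \<le> bm"
    using Max_in[OF fin(1)] Max_ge[OF fin(1)] \<open>j \<in> Cs\<close> unfolding bm_def by blast+
  have am: "am \<in> Gs" "\<And>N. N \<in> Gs \<Longrightarrow> N \<le> am"
    using Max_in[OF fin(2)] Max_ge[OF fin(2)] \<open>0 \<in> Gs\<close> unfolding am_def by blast+
  have "g (Suc (am + bm)) = (\<Sum>j\<le>am + bm. if j = bm then c bm * g am else 0)"
    unfolding g_def inverse_series_coeff.simps
  proof (rule sum.cong)
    fix j assume "j \<in> {..am + bm}"
    show "c j * inverse_series_coeff c (am + bm - j) = (if j = bm then c bm * inverse_series_coeff c am else 0)"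
    proof (cases "j < bm")
      case True
      then have "am + bm - j \<notin> Gs" using am(2) by fastforce
      then show ?thesis using True unfolding Gs_def g_def by simp
    next
      case False
      then have "j = bm \<or> j \<notin> Cs" using bm(2) by fastforce
      then show ?thesis unfolding Cs_def by auto
    qed
  qed simp
  also have "\<dots> = c bm * g am" by simp
  finally have "g (Suc (am + bm)) \<noteq> 0" using am(1) bm(1) unfolding Cs_def Gs_def by simp
  moreover have "Suc (am + bm) \<notin> Gs" using am(2) by fastforce
  ultimately show False unfolding Gs_def by simp
qed

lemma exists_coordinate_functional:
  fixes x :: "'a::field^'n"
  assumes "x \<noteq> 0"
  obtains \<phi> where "Vector_Spaces.linear (*s) (*) \<phi>" and "\<phi> x = 1"
proof -
  obtain i where i: "x $ i \<noteq> 0" using assms by (auto simp: vec_eq_iff)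
  have "Vector_Spaces.linear (*s) (*) (\<lambda>v. v $ i / x $ i)"
    by unfold_locales (simp_all add: add_divide_distrib)
  then show ?thesis using i that by simp
qed

lemma funpow_add_rank_one:
  fixes \<phi> :: "'a::field^'n \<Rightarrow> 'a"
  assumes E: "vec.subspace E" and x: "x \<in> E" and u: "\<forall>v\<in>E. u v \<in> E" "linear_on E u"
    and z: "linear_on E z" "\<And>v. v \<in> E \<Longrightarrow> z v = \<phi> (z v) *s x"
  shows "((u + z) ^^ N) x
    = (\<Sum>j\<le>N. inverse_series_coeff (\<lambda>j. \<phi> (z ((u ^^ j) x))) (N - j) *s (u ^^ j) x)"
proof -
  define w where "w = u + z"
  define c where "c j = \<phi> (z ((u ^^ j) x))" for j
  define g where "g = inverse_series_coeff c"
  have w_apply: "w v = u v + z v" for v by (simp add: w_def)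
  have wlin: "linear_on E w"
    using u(2) z(1) unfolding linear_on_def w_apply by (simp add: algebra_simps vector_add_ldistrib)
  have upow: "(u ^^ j) x \<in> E" for j using funpow_mem[OF u(1) x] .
  have "(w ^^ N) x = (\<Sum>j\<le>N. g (N - j) *s (u ^^ j) x)"
  proof (induction N)
    case 0
    then show ?case by (simp add: g_def)
  next
    case (Suc N)
    have "(w ^^ Suc N) x = w (\<Sum>j\<le>N. g (N - j) *s (u ^^ j) x)" by (simp add: Suc)
    also have "\<dots> = (\<Sum>j\<le>N. g (N - j) *s w ((u ^^ j) x))"
      using upow by (intro linear_on_sum[OF E wlin]) auto
    also have "\<dots> = (\<Sum>j\<le>N. g (N - j) *s (u ^^ Suc j) x) + (\<Sum>j\<le>N. g (N - j) * c j) *s x"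
    proof -
      have "g (N - j) *s w ((u ^^ j) x) = g (N - j) *s (u ^^ Suc j) x + (g (N - j) * c j) *s x"
        for j
        unfolding w_apply by (subst z(2)[OF upow]) (simp add: c_def vector_add_ldistrib)
      then show ?thesis by (simp add: sum.distrib vec.scale_sum_left)
    qed
    also have "(\<Sum>j\<le>N. g (N - j) * c j) = g (Suc N)"
      by (simp add: g_def mult.commute)
    also have "(\<Sum>j\<le>N. g (N - j) *s (u ^^ Suc j) x) + g (Suc N) *s x
        = (\<Sum>j\<le>Suc N. g (Suc N - j) *s (u ^^ j) x)"
      unfolding sum.atMost_Suc_shift by (simp add: add.commute del: sum.atMost_Suc)
    finally show ?case .
  qed
  then show ?thesis unfolding w_def g_def c_def .
qed

text \<open>The usual proof of this step compares traces of powers, which fails in characteristic 2.\<close>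

lemma rank_one_perturbation_nilpotent:
  fixes u z :: "'a::field^'n \<Rightarrow> 'a^'n"
  assumes E: "vec.subspace E" and x: "x \<in> E"
    and u: "\<forall>v\<in>E. u v \<in> E" "linear_on E u" "nilpotent_on E u"
    and z: "\<forall>v\<in>E. z v \<in> vec.span {x}" "linear_on E z" "z x = 0"
    and uz: "nilpotent_on E (u + z)"
  shows "z (u x) = 0"
proof (cases "x = 0")
  case True
  then show ?thesis using z(1) u(1) x by simp
next
  case False
  then obtain \<phi> where \<phi>: "Vector_Spaces.linear (*s) (*) \<phi>" "\<phi> x = 1"
    by (rule exists_coordinate_functional)
  have z_eq: "z v = \<phi> (z v) *s x" if "v \<in> E" for v
  proof -
    have "z v \<in> range (\<lambda>k. k *s x)" using z(1) that by (simp add: vec.span_singleton)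
    then obtain k where "z v = k *s x" by blast
    then show ?thesis using vec_scalar.linear_scale[OF \<phi>(1)] \<phi>(2) by simp
  qed
  define c where "c = (\<lambda>j. \<phi> (z ((u ^^ j) x)))"
  have "vec.span {x} \<subseteq> E" using vec.span_minimal[OF _ E] x by blast
  then have uzE: "\<forall>v\<in>E. (u + z) v \<in> E" using u(1) z(1) vec.subspace_add[OF E] by auto
  have z0: "z 0 = 0" and \<phi>0: "\<phi> 0 = 0"
    using linear_on_zero[OF E z(2)] vec_scalar.linear_0[OF \<phi>(1)] by auto
  obtain k where k: "\<forall>v\<in>E. ((u + z) ^^ k) v = 0" using uz unfolding nilpotent_on_def by blast
  obtain p where p: "\<forall>v\<in>E. (u ^^ p) v = 0" using u(3) unfolding nilpotent_on_def by blast
  have "\<forall>N\<ge>Suc k. inverse_series_coeff c N = 0"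
  proof (intro allI impI)
    fix N assume "Suc k \<le> N"
    then obtain M where M: "N = Suc M" "k \<le> M" by (cases N) auto
    have "((u + z) ^^ M) x = (\<Sum>j\<le>M. inverse_series_coeff c (M - j) *s (u ^^ j) x)"
      unfolding c_def by (rule funpow_add_rank_one[OF E x u(1,2) z(2) z_eq])
    then have "z (((u + z) ^^ M) x) = (\<Sum>j\<le>M. inverse_series_coeff c (M - j) *s z ((u ^^ j) x))"
      using funpow_mem[OF u(1) x] by (simp add: linear_on_sum[OF E z(2)])
    then have "\<phi> (z (((u + z) ^^ M) x)) = inverse_series_coeff c N"
      unfolding M(1) c_def
      by (simp add: vec_scalar.linear_sum[OF \<phi>(1)] vec_scalar.linear_scale[OF \<phi>(1)] mult.commute)
    then show "inverse_series_coeff c N = 0"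
      using funpow_eq_zero_beyond[OF uzE k M(2) x] z0 \<phi>0 by simp
  qed
  moreover have "\<forall>j\<ge>p. c j = 0"
    using funpow_eq_zero_beyond[OF u(1) p _ x] z0 \<phi>0 by (simp add: c_def)
  ultimately have "c 1 = 0" using inverse_series_coeff_eventually_zero_imp_zero by blast
  then show ?thesis using z_eq[OF u(1)[rule_format, OF x]] by (simp add: c_def)
qed

text \<open>The map induced by \<open>u\<close> on \<open>E / span {x}\<close>, realised on the complement
  \<open>E \<inter> ker \<phi>\<close> of \<open>x\<close> in \<open>E\<close>.\<close>

definition compression ::
    "('a::field^'n) set \<Rightarrow> 'a^'n \<Rightarrow> ('a^'n \<Rightarrow> 'a) \<Rightarrow> ('a^'n \<Rightarrow> 'a^'n) \<Rightarrow> 'a^'n \<Rightarrow> 'a^'n" where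
  "compression E x \<phi> u = zero_outside (E \<inter> {v. \<phi> v = 0}) (\<lambda>v. u v - \<phi> (u v) *s x)"

lemma linear_compression:
  assumes "Vector_Spaces.linear (*s) (*) \<phi>"
  shows "Vector_Spaces.linear endo_scale endo_scale (compression E x \<phi>)"
  by unfold_locales
    (auto simp: compression_def zero_outside_def endo_scale_def fun_eq_iff
      vec_scalar.linear_add[OF assms] vec_scalar.linear_scale[OF assms] algebra_simps
      vector_sadd_rdistrib vector_ssub_ldistrib)

context
  fixes E :: "('a::field^'n) set" and x :: "'a^'n" and \<phi> :: "'a^'n \<Rightarrow> 'a"
  assumes E: "vec.subspace E" and x: "x \<in> E"
    and \<phi>: "Vector_Spaces.linear (*s) (*) \<phi>" and \<phi>x: "\<phi> x = 1"
begin

lemma subspace_compression_domain: "vec.subspace (E \<inter> {v. \<phi> v = 0})"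
  by (rule vec.subspace_inter[OF E vec_scalar.linear_subspace_kernel[OF \<phi>]])

lemma dim_compression_domain_less: "vec.dim (E \<inter> {v. \<phi> v = 0}) < vec.dim E"
proof -
  have "x \<notin> E \<inter> {v. \<phi> v = 0}" using \<phi>x by simp
  then have "E \<inter> {v. \<phi> v = 0} \<subset> E" using x by blast
  then show ?thesis
    using vec.dim_psubset E subspace_compression_domain vec.span_eq_iff by metis
qed

lemma compression_apply:
  "v \<in> E \<inter> {v. \<phi> v = 0} \<Longrightarrow> compression E x \<phi> u v = u v - \<phi> (u v) *s x"
  by (simp add: compression_def zero_outside_def)

lemma hom_on_compression:
  assumes "hom_on E E u"
  shows "hom_on (E \<inter> {v. \<phi> v = 0}) (E \<inter> {v. \<phi> v = 0}) (compression E x \<phi> u)"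
proof -
  have "u (a + b) = u a + u b" "u (c *s a) = c *s u a" if "a \<in> E" "b \<in> E" for a b c
    using assms that unfolding hom_on_def linear_on_def by auto
  moreover have "u v - \<phi> (u v) *s x \<in> E" if "v \<in> E" for v
    using assms that x unfolding hom_on_def by (simp add: vec.subspace_diff[OF E] vec.subspace_scale[OF E])
  ultimately show ?thesis
    using subspace_compression_domain \<phi>x
    unfolding hom_on_def linear_on_def compression_def zero_outside_def
    by (auto simp: vec.subspace_add[OF E] vec.subspace_scale[OF E] vec_scalar.linear_add[OF \<phi>]
        vec_scalar.linear_scale[OF \<phi>] vec_scalar.linear_diff[OF \<phi>] algebra_simps
        vector_sadd_rdistrib vector_ssub_ldistrib)
qed

lemma proj_mem_compression_domain: "v \<in> E \<Longrightarrow> v - \<phi> v *s x \<in> E \<inter> {v. \<phi> v = 0}"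
  using x \<phi>x by (simp add: vec.subspace_diff[OF E] vec.subspace_scale[OF E]
      vec_scalar.linear_diff[OF \<phi>] vec_scalar.linear_scale[OF \<phi>])

lemma apply_proj_eq:
  assumes "linear_on E u" and "u x = 0" and "v \<in> E"
  shows "u (v - \<phi> v *s x) = u v"
proof -
  have "v - \<phi> v *s x \<in> E" and "\<phi> v *s x \<in> E"
    using proj_mem_compression_domain[OF assms(3)] x vec.subspace_scale[OF E] by auto
  then have "u ((v - \<phi> v *s x) + \<phi> v *s x) = u (v - \<phi> v *s x) + u (\<phi> v *s x)"
    using assms(1) unfolding linear_on_def by blast
  moreover have "u (\<phi> v *s x) = 0" using assms(1,2) x unfolding linear_on_def by simp
  ultimately show ?thesis by simp
qed

lemma funpow_compression:
  assumes u: "hom_on E E u" "u x = 0" and h: "h \<in> E \<inter> {v. \<phi> v = 0}"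
  shows "(compression E x \<phi> u ^^ m) h = (u ^^ m) h - \<phi> ((u ^^ m) h) *s x"
proof (induction m)
  case 0
  then show ?case using h by simp
next
  case (Suc m)
  have "(u ^^ m) h \<in> E" using funpow_mem[of E u] u(1) h unfolding hom_on_def by blast
  then show ?case
    using Suc proj_mem_compression_domain apply_proj_eq[of u, OF _ u(2)] u(1)
    unfolding hom_on_def by (simp add: compression_apply)
qed

lemma nilpotent_on_compression:
  assumes "hom_on E E u" and "u x = 0" and "nilpotent_on E u"
  shows "nilpotent_on (E \<inter> {v. \<phi> v = 0}) (compression E x \<phi> u)"
proof -
  obtain k where "\<forall>v\<in>E. (u ^^ k) v = 0" using assms(3) unfolding nilpotent_on_def by blast
  then have "\<forall>h\<in>E \<inter> {v. \<phi> v = 0}. (compression E x \<phi> u ^^ k) h = 0"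
    using funpow_compression[OF assms(1,2)] vec_scalar.linear_0[OF \<phi>] by simp
  then show ?thesis unfolding nilpotent_on_def by blast
qed

lemma compression_eq_zero_imp_rank_one:
  assumes "hom_on E E u" and "u x = 0" and "compression E x \<phi> u = 0" and "v \<in> E"
  shows "u v \<in> vec.span {x}"
proof -
  have "compression E x \<phi> u (v - \<phi> v *s x) = 0" using assms(3) by simp
  then have "u v = \<phi> (u v) *s x"
    using proj_mem_compression_domain[OF assms(4)] apply_proj_eq[of u, OF _ assms(2,4)] assms(1)
    unfolding hom_on_def by (simp add: compression_apply)
  then show ?thesis by (metis vec.span_base vec.span_scale singletonI)
qed

lemma eval_image_nilpotent:
  fixes N :: "('a^'n \<Rightarrow> 'a^'n) set"
  assumes N: "endo.subspace N" and hyp: "\<And>u. u \<in> N \<Longrightarrow> hom_on E E u \<and> nilpotent_on E u"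
  shows "vec.subspace ((\<lambda>u. u x) ` N)" and "(\<lambda>u. u x) ` N \<subseteq> E" and "x \<notin> (\<lambda>u. u x) ` N"
proof -
  show "vec.subspace ((\<lambda>u. u x) ` N)" by (rule endo_vec.linear_subspace_image[OF linear_eval N])
  show "(\<lambda>u. u x) ` N \<subseteq> E" using hyp x unfolding hom_on_def by auto
  show "x \<notin> (\<lambda>u. u x) ` N"
  proof
    assume "x \<in> (\<lambda>u. u x) ` N"
    then obtain u where u: "u \<in> N" "u x = x" by auto
    then have "(u ^^ j) x = x" for j by (induction j) auto
    moreover obtain k where "\<forall>v\<in>E. (u ^^ k) v = 0" using hyp[OF u(1)] unfolding nilpotent_on_def by blast
    ultimately show False using x \<phi>x vec_scalar.linear_0[OF \<phi>] by force
  qed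
qed

text \<open>The maps killed by evaluation at \<open>x\<close> and by compression map \<open>E\<close> into \<open>span {x}\<close>,
  and by \<open>rank_one_perturbation_nilpotent\<close> they also vanish on \<open>N x\<close>.\<close>

lemma dim_at_most_compression_kernel:
  fixes N :: "('a^'n \<Rightarrow> 'a^'n) set"
  assumes N: "endo.subspace N" and hyp: "\<And>u. u \<in> N \<Longrightarrow> hom_on E E u \<and> nilpotent_on E u"
  defines "Nx \<equiv> (\<lambda>u. u x) ` N"
  shows "endo.dim_at_most {u \<in> {u\<in>N. u x = 0}. compression E x \<phi> u = 0}
    (vec.dim E - Suc (vec.dim Nx))"
proof -
  note Nx = eval_image_nilpotent[OF N hyp, folded Nx_def]
  define A where "A = vec.span (insert x Nx)"
  have span_Nx: "vec.span Nx = Nx" using Nx(1) by simp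
  have "vec.dim A = Suc (vec.dim Nx)"
    unfolding A_def vec.dim_span vec.dim_insert span_Nx using Nx(3) by simp
  moreover have A: "vec.subspace A" "A \<subseteq> E"
    using vec.span_minimal[OF _ E, of "insert x Nx"] Nx(2) x unfolding A_def by auto
  moreover have "endo.dim_at_most {u \<in> {u\<in>N. u x = 0}. compression E x \<phi> u = 0}
      (vec.dim (vec.span {x}) * (vec.dim E - vec.dim A))"
  proof (rule dim_at_most_hom_on_vanishing[OF E A])
    show "endo.subspace {u \<in> {u\<in>N. u x = 0}. compression E x \<phi> u = 0}"
      by (intro endo_endo.subspace_kernel_within[OF linear_compression[OF \<phi>]]
          endo_vec.subspace_kernel_within[OF linear_eval N])
    fix u assume "u \<in> {u \<in> {u\<in>N. u x = 0}. compression E x \<phi> u = 0}"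
    then have u: "u \<in> N" "u x = 0" "compression E x \<phi> u = 0" by auto
    have hom: "hom_on E E u" using hyp[OF u(1)] by blast
    then show "hom_on E (vec.span {x}) u"
      using compression_eq_zero_imp_rank_one[OF _ u(2,3)] unfolding hom_on_def by blast
    have "u (w x) = 0" if w: "w \<in> N" for w
    proof (rule rank_one_perturbation_nilpotent[OF E x, of w u])
      show "\<forall>v\<in>E. w v \<in> E" "linear_on E w" "nilpotent_on E w"
        using hyp[OF w] unfolding hom_on_def by auto
      show "\<forall>v\<in>E. u v \<in> vec.span {x}" "linear_on E u" "u x = 0"
        using compression_eq_zero_imp_rank_one[OF hom u(2,3)] hom u(2) unfolding hom_on_def by auto
      show "nilpotent_on E (w + u)" using hyp endo.subspace_add[OF N w u(1)] by blast
    qed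
    then have "\<forall>a\<in>insert x Nx. u a = 0" using u(2) unfolding Nx_def by auto
    then show "u a = 0" if "a \<in> A" for a
      using linear_on_span_eq_zero[OF E _ _ _ that[unfolded A_def]] hom Nx(2) x
      unfolding hom_on_def by auto
  qed
  moreover have "x \<noteq> 0" using \<phi>x vec_scalar.linear_0[OF \<phi>] by auto
  ultimately show ?thesis by simp
qed

lemma dim_at_most_nilpotent_step:
  fixes N :: "('a^'n \<Rightarrow> 'a^'n) set"
  assumes N: "endo.subspace N" and hyp: "\<And>u. u \<in> N \<Longrightarrow> hom_on E E u \<and> nilpotent_on E u"
    and IH: "endo.dim_at_most (compression E x \<phi> ` {u\<in>N. u x = 0}) k"
  shows "endo.dim_at_most N (k + vec.dim E - 1)"
proof -
  define Nx where "Nx = (\<lambda>u. u x) ` N"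
  note Nx = eval_image_nilpotent[OF N hyp, folded Nx_def]
  have "endo.dim_at_most {u\<in>N. u x = 0} (k + (vec.dim E - Suc (vec.dim Nx)))"
    using endo_endo.dim_at_most_rank_nullity[OF linear_compression[OF \<phi>]
        endo_vec.subspace_kernel_within[OF linear_eval N] IH
        dim_at_most_compression_kernel[OF N hyp, folded Nx_def]] .
  then have "endo.dim_at_most N (vec.dim Nx + (k + (vec.dim E - Suc (vec.dim Nx))))"
    using endo_vec.dim_at_most_rank_nullity[OF linear_eval N vec.dim_at_most_dim[OF subset_refl]]
    unfolding Nx_def by simp
  moreover have "vec.dim Nx < vec.dim E"
    using Nx x vec.dim_psubset E vec.span_eq_iff by (metis psubsetI)
  ultimately show ?thesis by (simp add: add.commute)
qed

end

lemma dim_at_most_nilpotent_hom_on: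
  fixes N :: "('a::field^'n \<Rightarrow> 'a^'n) set"
  assumes "vec.subspace E" and "vec.dim E \<le> d" and "endo.subspace N"
    and "\<And>u. u \<in> N \<Longrightarrow> hom_on E E u \<and> nilpotent_on E u"
  shows "endo.dim_at_most N (d * (d - 1) div 2)"
  using assms
proof (induction d arbitrary: E N rule: less_induct)
  case (less d)
  show ?case
  proof (cases "E \<subseteq> {0}")
    case True
    then have "N \<subseteq> {0}" using hom_on_zero_space less.prems(1,4) by blast
    then show ?thesis using endo.dim_at_most_zero endo.dim_at_most_mono by blast
  next
    case False
    then obtain x where x: "x \<in> E" "x \<noteq> 0" by blast
    obtain \<phi> where \<phi>: "Vector_Spaces.linear (*s) (*) \<phi>" "\<phi> x = 1"
      by (rule exists_coordinate_functional[OF x(2)])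
    let ?H = "E \<inter> {v. \<phi> v = 0}" and ?C = "compression E x \<phi> ` {u\<in>N. u x = 0}"
    obtain e where d: "d = Suc e" and dim_H: "vec.dim ?H \<le> e"
      using dim_compression_domain_less[OF less.prems(1) x(1) \<phi>] less.prems(2) by (cases d) auto
    have "endo.dim_at_most ?C (e * (e - 1) div 2)"
    proof (rule less.IH[OF _ subspace_compression_domain[OF less.prems(1) x(1) \<phi>] dim_H])
      show "e < d" using d by simp
      show "endo.subspace ?C"
        by (rule endo_endo.linear_subspace_image[OF linear_compression[OF \<phi>(1)]
              endo_vec.subspace_kernel_within[OF linear_eval less.prems(3)]])
      show "hom_on ?H ?H w \<and> nilpotent_on ?H w" if "w \<in> ?C" for w
        using that less.prems(4) hom_on_compression[OF less.prems(1) x(1) \<phi>]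
          nilpotent_on_compression[OF less.prems(1) x(1) \<phi>] by auto
    qed
    then have "endo.dim_at_most N (e * (e - 1) div 2 + vec.dim E - 1)"
      using dim_at_most_nilpotent_step[OF less.prems(1) x(1) \<phi> less.prems(3,4)] by blast
    moreover have "e * (e - 1) div 2 + vec.dim E - 1 \<le> d * (d - 1) div 2"
      using less.prems(2) unfolding d by (cases e) (simp_all add: algebra_simps)
    ultimately show ?thesis by (rule endo.dim_at_most_mono)
  qed
qed

lemma dim_at_most_restrict_nilpotent:
  fixes V :: "('a::field^'n \<Rightarrow> 'a^'n) set"
  assumes E: "vec.subspace E" and V: "endo.subspace V"
    and "\<And>u. u \<in> V \<Longrightarrow> is_endo u" and "\<And>u. u \<in> V \<Longrightarrow> nilpotent_endo u"
    and "\<And>u v. u \<in> V \<Longrightarrow> v \<in> E \<Longrightarrow> u v \<in> E"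
  shows "endo.dim_at_most (zero_outside E ` V) (vec.dim E * (vec.dim E - 1) div 2)"
proof (rule dim_at_most_nilpotent_hom_on[OF E order_refl])
  show "endo.subspace (zero_outside E ` V)"
    by (rule endo_endo.linear_subspace_image[OF linear_zero_outside V])
  fix w assume "w \<in> zero_outside E ` V"
  then obtain u where u: "u \<in> V" and w: "w = zero_outside E u" by blast
  have inv: "\<forall>v\<in>E. u v \<in> E" using assms(5)[OF u] by blast
  obtain k where "u ^^ k = (\<lambda>_. 0)" using assms(4)[OF u] unfolding nilpotent_endo_def by blast
  then have "\<forall>v\<in>E. (w ^^ k) v = 0" using funpow_zero_outside[OF inv] unfolding w by simp
  then show "hom_on E E w \<and> nilpotent_on E w"
    using hom_on_zero_outside[OF E assms(3)[OF u] inv] w unfolding nilpotent_on_def by blast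
qed

section \<open>The quadratic form in characteristic 2\<close>

lemma subspace_KerQ:
  assumes char2: "(2::'a::field) = 0" and bil: "bilinear_form (b :: 'a^'n \<Rightarrow> 'a^'n \<Rightarrow> 'a)"
    and sym: "symmetric_form b"
  shows "vec.subspace (KerQ b)"
  unfolding vec.subspace_def KerQ_def
proof (intro conjI ballI allI)
  fix x y assume "x \<in> {x. b x x = 0}" and "y \<in> {x. b x x = 0}"
  moreover have "b (x + y) (x + y) = b x x + b y y + 2 * b x y"
    using sym unfolding symmetric_form_def
    by (simp add: bilinear_form_add_left[OF bil] bilinear_form_add_right[OF bil] algebra_simps)
  ultimately show "x + y \<in> {x. b x x = 0}" using char2 by simp
qed (simp_all add: bilinear_form_zero_left[OF bil] bilinear_form_scale_left[OF bil]
      bilinear_form_scale_right[OF bil])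

lemma A_b_subset_S_b:
  assumes char2: "(2::'a::field) = 0" and bil: "bilinear_form (b :: 'a^'n \<Rightarrow> 'a^'n \<Rightarrow> 'a)"
  shows "A_b b \<subseteq> S_b b"
proof
  fix u assume "u \<in> A_b b"
  then have endo: "is_endo u" and alt: "\<And>x. b x (u x) = 0" unfolding A_b_def by auto
  have "b x (u y) = b y (u x)" for x y
  proof -
    have "0 = b (x + y) (u (x + y))" using alt by simp
    also have "\<dots> = b x (u y) + b y (u x)"
      using alt unfolding is_endo_def
      by (simp add: vec.linear_add[OF endo[unfolded is_endo_def]] bilinear_form_add_left[OF bil]
          bilinear_form_add_right[OF bil])
    finally have "b x (u y) = - b y (u x)" by (simp add: eq_neg_iff_add_eq_0)
    also have "\<dots> = b y (u x)" using char2 by (metis add_eq_0_iff2 mult_2 mult_zero_left)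
    finally show ?thesis .
  qed
  then show "u \<in> S_b b" using endo unfolding S_b_def by simp
qed

lemma self_adjoint_if_S_b: "symmetric_form b \<Longrightarrow> u \<in> S_b b \<Longrightarrow> self_adjoint b u"
  unfolding self_adjoint_def symmetric_form_def S_b_def by simp

lemma self_adjoint_funpow:
  assumes "self_adjoint b u"
  shows "self_adjoint b (u ^^ i)"
  unfolding self_adjoint_def
proof (induction i)
  case (Suc i)
  then show ?case
    using assms unfolding self_adjoint_def by (metis funpow_Suc_right o_apply funpow.simps(2))
qed simp

lemma zero_by_doubling:
  fixes a :: "nat \<Rightarrow> 'a::zero"
  assumes "\<forall>m\<ge>N. a m = 0" and "\<And>m. 0 < m \<Longrightarrow> a (2 * m) = 0 \<Longrightarrow> a m = 0" and "0 < m"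
  shows "a m = 0"
  using assms(3)
proof (induction "N - m" arbitrary: m rule: less_induct)
  case less
  show ?case
  proof (cases "N \<le> m")
    case True
    then show ?thesis using assms(1) by simp
  next
    case False
    then have "a (2 * m) = 0" using less by simp
    then show ?thesis using assms(2) less.prems by blast
  qed
qed

lemma nilpotent_self_adjoint_image_orth_KerQ:
  assumes bil: "bilinear_form b" and u: "self_adjoint b u" "nilpotent_endo u"
    and x: "x \<in> orth b (KerQ b)"
  shows "u x \<in> KerQ b"
proof -
  obtain N where N: "u ^^ N = (\<lambda>_. 0)" using u(2) unfolding nilpotent_endo_def by blast
  define a where "a m = b x ((u ^^ m) x)" for m
  have double: "a (2 * m) = b ((u ^^ m) x) ((u ^^ m) x)" for m
    using self_adjoint_funpow[OF u(1), of m] unfolding self_adjoint_def a_def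
    by (simp add: mult_2 funpow_add)
  have "\<forall>m\<ge>N. a m = 0"
  proof (intro allI impI)
    fix m assume "N \<le> m"
    then have "(u ^^ m) x = (u ^^ N) ((u ^^ (m - N)) x)"
      by (metis funpow_add le_add_diff_inverse comp_apply)
    then show "a m = 0" using N bilinear_form_zero_right[OF bil] by (simp add: a_def)
  qed
  moreover have "a m = 0" if "a (2 * m) = 0" for m
  proof -
    have "(u ^^ m) x \<in> KerQ b" using that double[of m] by (simp add: KerQ_def)
    then show "a m = 0" using x unfolding a_def orth_def by blast
  qed
  ultimately have "a 2 = 0" by (rule zero_by_doubling[of N a]) simp_all
  then show ?thesis using double[of 1] by (simp add: KerQ_def)
qed

lemma self_adjoint_vanishing_image_orth:
  assumes "bilinear_form b" and "self_adjoint b u" and "\<forall>p\<in>P. u p = 0"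
  shows "u v \<in> orth b P"
  using assms(2,3) bilinear_form_zero_right[OF assms(1)]
  unfolding self_adjoint_def orth_def by simp

section \<open>Nilpotent subspaces of \<open>S\<^sub>b\<close> and \<open>A\<^sub>b\<close>\<close>

text \<open>The filtration \<open>V \<supseteq> {u. u|K = 0} \<supseteq> {u. u|P = 0}\<close>: the first quotient is a nilpotent
  space of endomorphisms of \<open>K\<close>, the second one a space of maps \<open>P \<rightarrow> K\<close> vanishing on \<open>K\<close>.\<close>

lemma dim_at_most_nilpotent_S_b:
  fixes b :: "'a::field^'n \<Rightarrow> 'a^'n \<Rightarrow> 'a" and V :: "('a^'n \<Rightarrow> 'a^'n) set"
  defines "K \<equiv> KerQ b" and "P \<equiv> orth b (KerQ b)"
  assumes char2: "(2::'a) = 0" and bil: "bilinear_form b" and sym: "symmetric_form b"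
    and ker_ts: "totally_singular b K"
    and V: "endo.subspace V" "V \<subseteq> S_b b" "\<forall>u\<in>V. nilpotent_endo u"
    and V1: "endo.dim_at_most {u\<in>V. \<forall>p\<in>P. u p = 0} s"
  shows "endo.dim_at_most V
    (vec.dim K * (vec.dim K - 1) div 2 + vec.dim K * (vec.dim P - vec.dim K) + s)"
proof -
  have K: "vec.subspace K" unfolding K_def by (rule subspace_KerQ[OF char2 bil sym])
  have P: "vec.subspace P" unfolding P_def by (rule subspace_orth[OF bil])
  have KP: "K \<subseteq> P" using ker_ts unfolding totally_singular_def orth_def P_def K_def by blast
  have endo: "is_endo u" if "u \<in> V" for u using V(2) that unfolding S_b_def by blast
  have maps: "u v \<in> K" if "u \<in> V" "v \<in> P" for u v
    using nilpotent_self_adjoint_image_orth_KerQ[OF bil self_adjoint_if_S_b[OF sym]] V that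
    unfolding K_def P_def by blast
  define V0 where "V0 = {u\<in>V. zero_outside K u = 0}"
  have V0: "endo.subspace V0"
    unfolding V0_def by (rule endo_endo.subspace_kernel_within[OF linear_zero_outside V(1)])
  have img1: "endo.dim_at_most (zero_outside K ` V) (vec.dim K * (vec.dim K - 1) div 2)"
    using endo V(3) maps KP by (intro dim_at_most_restrict_nilpotent[OF K V(1)]) blast+
  have img2: "endo.dim_at_most (zero_outside P ` V0) (vec.dim K * (vec.dim P - vec.dim K))"
  proof (rule dim_at_most_hom_on_vanishing[OF P K KP])
    show "endo.subspace (zero_outside P ` V0)"
      by (rule endo_endo.linear_subspace_image[OF linear_zero_outside V0])
    fix w assume "w \<in> zero_outside P ` V0"
    then obtain u where u: "u \<in> V" "zero_outside K u = 0" and w: "w = zero_outside P u"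
      unfolding V0_def by blast
    show "hom_on P K w"
      unfolding w by (rule hom_on_zero_outside[OF P endo[OF u(1)]]) (use maps u in blast)
    show "w a = 0" if "a \<in> K" for a
      using that fun_cong[OF u(2), of a] KP unfolding w zero_outside_def by auto
  qed
  have "{u\<in>V0. zero_outside P u = 0} = {u\<in>V. \<forall>p\<in>P. u p = 0}"
    using KP unfolding V0_def zero_outside_def by (auto simp: fun_eq_iff)
  then have "endo.dim_at_most V0 (vec.dim K * (vec.dim P - vec.dim K) + s)"
    using endo_endo.dim_at_most_rank_nullity[OF linear_zero_outside V0 img2] V1 by simp
  then show ?thesis
    using endo_endo.dim_at_most_rank_nullity[OF linear_zero_outside V(1) img1]
    unfolding V0_def by (simp add: add.assoc)
qed

lemma triangle_double: "t * (t - 1) div 2 + t * (t - 1) div 2 = t * (t - 1::nat)"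
proof -
  have "even (t * (t - 1))" by (cases t) auto
  then show ?thesis by (metis mult_2 even_two_times_div_two)
qed

lemma triangle_add_triangle: "t * (t - 1) div 2 + t * (t + 1) div 2 = t * (t::nat)"
proof -
  have "t * (t + 1) = t * (t - 1) + 2 * t" by (cases t) (simp_all add: algebra_simps)
  then have "t * (t + 1) div 2 = t * (t - 1) div 2 + t" by simp
  then show ?thesis using triangle_double[of t] by (cases t) (simp_all add: algebra_simps)
qed

lemma subspace_vanishing_on:
  "endo.subspace V \<Longrightarrow> endo.subspace {u\<in>V. \<forall>p\<in>P. u p = 0}"
  unfolding endo.subspace_def by (simp add: endo_scale_def)

lemma dim_KerQ_orth:
  fixes b :: "'a::field^'n \<Rightarrow> 'a^'n \<Rightarrow> 'a"
  assumes bil: "bilinear_form b" and nondeg: "nondegenerate_form b"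
    and ker_ts: "totally_singular b (KerQ b)"
  shows "vec.dim (KerQ b) + vec.dim (orth b (KerQ b)) = CARD('n)"
    and "vec.dim (KerQ b) \<le> vec.dim (orth b (KerQ b))"
    and "vec.dim (orth b (orth b (KerQ b))) = vec.dim (KerQ b)"
proof -
  show n: "vec.dim (KerQ b) + vec.dim (orth b (KerQ b)) = CARD('n)"
    by (rule dim_orth[OF bil nondeg])
  show "vec.dim (KerQ b) \<le> vec.dim (orth b (KerQ b))"
    using ker_ts unfolding totally_singular_def orth_def by (intro vec.dim_subset) blast
  show "vec.dim (orth b (orth b (KerQ b))) = vec.dim (KerQ b)"
    using dim_orth[OF bil nondeg, of "orth b (KerQ b)"] n by simp
qed

lemma dim_nilpotent_S_b:
  fixes b :: "'a::field^'n \<Rightarrow> 'a^'n \<Rightarrow> 'a" and V :: "('a^'n \<Rightarrow> 'a^'n) set"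
  defines "\<nu> \<equiv> vec.dim (KerQ b)"
  assumes char2: "(2::'a) = 0" and bil: "bilinear_form b" and sym: "symmetric_form b"
    and nondeg: "nondegenerate_form b" and ker_ts: "totally_singular b (KerQ b)"
    and V: "endo.subspace V" "V \<subseteq> S_b b" "\<forall>u\<in>V. nilpotent_endo u"
  shows "int (endo.dim V) \<le> int \<nu> * (int CARD('n) - int \<nu>)"
proof -
  define P where "P = orth b (KerQ b)"
  note dims = dim_KerQ_orth[OF bil nondeg ker_ts, folded \<nu>_def P_def]
  have "endo.dim_at_most {u\<in>V. \<forall>p\<in>P. u p = 0} (\<nu> * (\<nu> + 1) div 2)"
    using self_adjoint_if_S_b[OF sym] self_adjoint_vanishing_image_orth[OF bil] V(2) dims(3)
    by (intro dim_at_most_self_adjoint[OF bil nondeg subspace_orth[OF bil]]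
        subspace_vanishing_on[OF V(1)]) blast+
  then have "endo.dim V \<le> \<nu> * (\<nu> - 1) div 2 + \<nu> * (vec.dim P - \<nu>) + \<nu> * (\<nu> + 1) div 2"
    using dim_at_most_nilpotent_S_b[OF char2 bil sym ker_ts V] endo.dim_le_if_dim_at_most
    unfolding \<nu>_def P_def by blast
  also have "\<dots> = \<nu> * (\<nu> + (vec.dim P - \<nu>))"
    using triangle_add_triangle[of \<nu>] by (simp add: add_mult_distrib2)
  also have "\<dots> = \<nu> * vec.dim P" using dims(2) by simp
  finally have "int (endo.dim V) \<le> int \<nu> * int (vec.dim P)" by (simp flip: of_nat_mult)
  then show ?thesis by (simp flip: dims(1))
qed

lemma dim_nilpotent_A_b:
  fixes b :: "'a::field^'n \<Rightarrow> 'a^'n \<Rightarrow> 'a" and V :: "('a^'n \<Rightarrow> 'a^'n) set"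
  defines "\<nu> \<equiv> vec.dim (KerQ b)"
  assumes char2: "(2::'a) = 0" and bil: "bilinear_form b" and sym: "symmetric_form b"
    and nondeg: "nondegenerate_form b" and ker_ts: "totally_singular b (KerQ b)"
    and V: "endo.subspace V" "V \<subseteq> A_b b" "\<forall>u\<in>V. nilpotent_endo u"
  shows "int (endo.dim V) \<le> int \<nu> * (int CARD('n) - int \<nu> - 1)"
proof -
  define P where "P = orth b (KerQ b)"
  note dims = dim_KerQ_orth[OF bil nondeg ker_ts, folded \<nu>_def P_def]
  have VS: "V \<subseteq> S_b b" using V(2) A_b_subset_S_b[OF char2 bil] by blast
  have "endo.dim_at_most {u\<in>V. \<forall>p\<in>P. u p = 0} (\<nu> * (\<nu> - 1) div 2)"
    using self_adjoint_if_S_b[OF sym] self_adjoint_vanishing_image_orth[OF bil] VS V(2) dims(3)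
    by (intro dim_at_most_alternating_self_adjoint[OF bil nondeg subspace_orth[OF bil]]
        subspace_vanishing_on[OF V(1)]) (auto simp: A_b_def)
  then have "endo.dim V \<le> \<nu> * (\<nu> - 1) div 2 + \<nu> * (vec.dim P - \<nu>) + \<nu> * (\<nu> - 1) div 2"
    using dim_at_most_nilpotent_S_b[OF char2 bil sym ker_ts V(1) VS V(3)] endo.dim_le_if_dim_at_most
    unfolding \<nu>_def P_def by blast
  also have "\<dots> = \<nu> * ((\<nu> - 1) + (vec.dim P - \<nu>))"
    using triangle_double[of \<nu>] by (simp add: add_mult_distrib2)
  also have "\<dots> = \<nu> * (vec.dim P - 1)" using dims(2) by (cases \<nu>) simp_all
  finally have "int (endo.dim V) \<le> int (\<nu> * (vec.dim P - 1))" by (rule of_nat_mono)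
  also have "\<dots> = int \<nu> * (int CARD('n) - int \<nu> - 1)"
    using dims(2) by (cases \<nu>) (simp_all flip: dims(1) add: of_nat_diff algebra_simps)
  finally show ?thesis .
qed

theorem proposition5p2:
  fixes b :: "'a::field^'n \<Rightarrow> 'a^'n \<Rightarrow> 'a"
  assumes char2: "(2::'a) = 0"
    and bil: "bilinear_form b" and sym: "symmetric_form b" and nondeg: "nondegenerate_form b"
    and ker_ts: "totally_singular b (KerQ b)"
  shows "(\<forall>\<V>. module.subspace endo_scale \<V> \<and> \<V> \<subseteq> S_b b \<and> (\<forall>u\<in>\<V>. nilpotent_endo u) \<longrightarrow>
            int (vector_space.dim endo_scale \<V>)
              \<le> int (vec.dim (KerQ b)) * (int CARD('n) - int (vec.dim (KerQ b))))
       \<and> (\<forall>\<V>. module.subspace endo_scale \<V> \<and> \<V> \<subseteq> A_b b \<and> (\<forall>u\<in>\<V>. nilpotent_endo u) \<longrightarrow>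
            int (vector_space.dim endo_scale \<V>)
              \<le> int (vec.dim (KerQ b)) * (int CARD('n) - int (vec.dim (KerQ b)) - 1))"
  using dim_nilpotent_S_b[OF char2 bil sym nondeg ker_ts]
    dim_nilpotent_A_b[OF char2 bil sym nondeg ker_ts]
  by blast

end
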